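(* Let $a,b$ be non-negative integers. Then $$\sum_{i=0}^{a}\sum_{j=0}^{b}N_{i,j}(a,b)=\delta^a_0\,\delta^b_0 .$$
   Context: $q$ is a prime power (or $q=1$, in which case $q$-binomial coefficients are ordinary binomial coefficients). $\left[\begin{smallmatrix} n \\ k \end{smallmatrix}\right]_q$ denotes the $q$-binomial coefficient, equal to $0$ if $k>n$. $\delta^a_b$ is the Kronecker delta ($1$ if $a=b$, $0$ otherwise). For non-negative integers define $$\alpha_q(n,m;i,j):=\left[\begin{matrix} n \\ i \end{matrix}\right]_q\left[\begin{matrix} m \\ j \end{matrix}\right]_q q^{(n-i)(m-j)},$$ $$\beta_q(a,b;c,d):=(-1)^{(a-c)+(b-d)}\left[\begin{matrix} a \\ c \end{matrix}\right]_q\left[\begin{matrix} b \\ d \end{matrix}\right]_q q^{\binom{|(a-c)-(b-d)|}{2}}\bigl(1+q^{|(a-c)-(b-d)|}-q^{\max(a-c,\,b-d)}\bigr).$$ For non-negative integers $u\le a$, $v\le b$ and $i,j$, with $c=u+i$ and $d=v+j$, one sets $$N_{i,j}(a-u,b-v):=\alpha_q(a,b;c,d)\,\beta_q(c,d;u,v)\left(\left[\begin{matrix} a \\ u \end{matrix}\right]_q\left[\begin{matrix} b \\ v \end{matrix}\right]_q\right)^{-1},$$ which depends only on $a-u$, $b-v$, $i$, $j$. Explicitly, $$N_{i,j}(a,b)=(-1)^{i+j}\left[\begin{matrix} a \\ i \end{matrix}\right]_q\left[\begin{matrix} b \\ j \end{matrix}\right]_q q^{(a-i)(b-j)}q^{\binom{|i-j|}{2}}\bigl(1+q^{|i-j|}-q^{\max(i,j)}\bigr).$$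 *)

theory Defs
  imports Complex_Main "HOL-Number_Theory.Prime_Powers"
begin

text \<open>
  The Gaussian binomial is defined through the numbers \<open>1 + q + \<dots> + q^(n-1)\<close> rather than
  \<open>(q^n - 1) / (q - 1)\<close>, so that one definition covers prime powers and \<open>q = 1\<close>.
\<close>

definition qnum :: "nat \<Rightarrow> nat \<Rightarrow> real" where
  "qnum q n = (\<Sum>i<n. real q ^ i)"

definition qfact :: "nat \<Rightarrow> nat \<Rightarrow> real" where
  "qfact q n = (\<Prod>i=1..n. qnum q i)"

definition qbinom :: "nat \<Rightarrow> nat \<Rightarrow> nat \<Rightarrow> real" where
  "qbinom q n k = (if k \<le> n then qfact q n / (qfact q k * qfact q (n - k)) else 0)"

text \<open>
  In \<open>alpha\<close> and \<open>beta\<close> the natural-number subtractions truncate only when one of the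
  Gaussian binomials in the same product vanishes.
\<close>

definition alpha :: "nat \<Rightarrow> nat \<Rightarrow> nat \<Rightarrow> nat \<Rightarrow> nat \<Rightarrow> real" where
  "alpha q n m i j = qbinom q n i * qbinom q m j * real q ^ ((n - i) * (m - j))"

definition beta :: "nat \<Rightarrow> nat \<Rightarrow> nat \<Rightarrow> nat \<Rightarrow> nat \<Rightarrow> real" where
  "beta q a b c d =
     (let e = nat \<bar>int (a - c) - int (b - d)\<bar> in
      (-1) ^ ((a - c) + (b - d)) * qbinom q a c * qbinom q b d * real q ^ (e choose 2)
        * (1 + real q ^ e - real q ^ max (a - c) (b - d)))"

text \<open>
  The quantity \<open>N\<^sub>i\<^sub>,\<^sub>j(a - u, b - v)\<close>, a priori depending on \<open>a, b, u, v\<close>, is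
  \<open>Nraw q a b u v i j\<close>; \<open>N q i j a b\<close> takes the representative \<open>u = v = 0\<close>, which
  is justified by \<open>Nraw_eq_N\<close> below.
\<close>

definition Nraw :: "nat \<Rightarrow> nat \<Rightarrow> nat \<Rightarrow> nat \<Rightarrow> nat \<Rightarrow> nat \<Rightarrow> nat \<Rightarrow> real" where
  "Nraw q a b u v i j =
     alpha q a b (u + i) (v + j) * beta q (u + i) (v + j) u v
       * inverse (qbinom q a u * qbinom q b v)"

definition N :: "nat \<Rightarrow> nat \<Rightarrow> nat \<Rightarrow> nat \<Rightarrow> nat \<Rightarrow> real" where
  "N q i j a b = Nraw q a b 0 0 i j"

lemma qnum_pos: "q > 0 \<Longrightarrow> n > 0 \<Longrightarrow> qnum q n > 0"
  unfolding qnum_def by (intro sum_pos) auto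

lemma qfact_pos: "q > 0 \<Longrightarrow> qfact q n > 0"
  unfolding qfact_def by (intro prod_pos) (auto intro: qnum_pos)

lemma qfact_0 [simp]: "qfact q 0 = 1"
  by (simp add: qfact_def)

lemma qbinom_0: "q > 0 \<Longrightarrow> qbinom q n 0 = 1"
  using qfact_pos[of q n] by (simp add: qbinom_def)

lemma qbinom_self: "q > 0 \<Longrightarrow> qbinom q n n = 1"
  using qfact_pos[of q n] by (simp add: qbinom_def)

lemma qbinom_1: "qbinom 1 n k = real (n choose k)"
proof -
  have "qfact 1 m = fact m" for m
    by (simp add: qfact_def qnum_def fact_prod)
  then show ?thesis
    by (simp add: qbinom_def binomial_fact binomial_eq_0)
qed

lemma qnum_geometric: "q \<noteq> 1 \<Longrightarrow> qnum q n = (real q ^ n - 1) / (real q - 1)"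
  unfolding qnum_def by (rule geometric_sum) simp

lemma qbinom_prod:
  assumes "q > 1" "k \<le> n"
  shows "qbinom q n k = (\<Prod>i<k. (real q ^ (n - i) - 1) / (real q ^ (i + 1) - 1))"
  using assms(2)
proof (induction k)
  case 0
  then show ?case using assms(1) by (simp add: qbinom_0)
next
  case (Suc k)
  have pos: "qfact q m > 0" for m using assms(1) by (simp add: qfact_pos)
  have "n - k = Suc (n - Suc k)" using Suc.prems by simp
  then have 1: "qfact q (n - k) = qfact q (n - Suc k) * qnum q (n - k)"
    by (simp add: qfact_def)
  have 2: "qfact q (Suc k) = qfact q k * qnum q (Suc k)"
    by (simp add: qfact_def)
  have nz: "qnum q (n - k) > 0" "qnum q (Suc k) > 0"
    using Suc.prems assms(1) by (auto intro!: qnum_pos)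
  have "qbinom q n (Suc k) = qbinom q n k * (qnum q (n - k) / qnum q (Suc k))"
    using Suc.prems pos[of k] pos[of "n - Suc k"] nz
    by (simp add: qbinom_def 1 2 field_simps)
  moreover have "qnum q (n - k) / qnum q (Suc k) = (real q ^ (n - k) - 1) / (real q ^ (k + 1) - 1)"
    using assms(1) by (simp add: qnum_geometric)
  ultimately show ?case using Suc by simp
qed

lemma qbinom_mult:
  assumes "q > 0" "u \<le> a"
  shows "qbinom q a (u + i) * qbinom q (u + i) u = qbinom q a u * qbinom q (a - u) i"
proof (cases "u + i \<le> a")
  case True
  have pos: "qfact q m > 0" for m using assms(1) by (simp add: qfact_pos)
  show ?thesis
    using True pos[of u] pos[of i] pos[of "u + i"] pos[of "a - u"] pos[of "a - (u + i)"]
    by (simp add: qbinom_def field_simps)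
next
  case False
  then show ?thesis using assms by (simp add: qbinom_def)
qed

lemma N_explicit:
  assumes "q > 0"
  shows "N q i j a b =
    (-1) ^ (i + j) * qbinom q a i * qbinom q b j * real q ^ ((a - i) * (b - j))
      * real q ^ (nat \<bar>int i - int j\<bar> choose 2)
      * (1 + real q ^ nat \<bar>int i - int j\<bar> - real q ^ max i j)"
  using assms by (simp add: N_def Nraw_def alpha_def beta_def Let_def qbinom_0)

lemma Nraw_eq_N:
  assumes "q > 0" "u \<le> a" "v \<le> b"
  shows "Nraw q a b u v i j = N q i j (a - u) (b - v)"
proof -
  let ?e = "nat \<bar>int i - int j\<bar>"
  have nz: "qbinom q a u \<noteq> 0" "qbinom q b v \<noteq> 0"
    using assms qfact_pos[of q] by (auto simp: qbinom_def less_imp_neq[symmetric])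
  have cancel: "(qbinom q a u * x) * (qbinom q b v * y) * inverse (qbinom q a u * qbinom q b v)
      = x * y" for x y
    using nz by (simp add: field_simps)
  have "Nraw q a b u v i j =
      (qbinom q a (u + i) * qbinom q (u + i) u) * (qbinom q b (v + j) * qbinom q (v + j) v)
        * inverse (qbinom q a u * qbinom q b v)
        * ((-1) ^ (i + j) * real q ^ ((a - u - i) * (b - v - j)) * real q ^ (?e choose 2)
            * (1 + real q ^ ?e - real q ^ max i j))"
    by (simp add: Nraw_def alpha_def beta_def Let_def mult_ac)
  also have "\<dots> = qbinom q (a - u) i * qbinom q (b - v) j
        * ((-1) ^ (i + j) * real q ^ ((a - u - i) * (b - v - j)) * real q ^ (?e choose 2)
            * (1 + real q ^ ?e - real q ^ max i j))"
    unfolding qbinom_mult[OF assms(1,2)] qbinom_mult[OF assms(1,3)] cancel ..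
  also have "\<dots> = N q i j (a - u) (b - v)"
    using assms(1) by (simp add: N_explicit mult_ac)
  finally show ?thesis .
qed

end

theory Submission
  imports Defs
begin

text \<open>
  The double sum factors into single sums that the \<open>q\<close>-binomial theorem evaluates. Read
  \<open>d = i - j\<close> as an integer and \<open>binom(d, 2)\<close> as \<open>d (d - 1) / 2\<close>, so that
  \<open>binom(d, 2) + \<bar>d\<bar> = binom(-d, 2)\<close> for \<open>d \<ge> 0\<close>. Then the two monomials
  \<open>q^binom(\<bar>d\<bar>, 2)\<close> and \<open>q^(binom(\<bar>d\<bar>, 2) + \<bar>d\<bar>)\<close> are, in one order or the other,
  \<open>q^binom(i - j, 2)\<close> and \<open>q^binom(j - i, 2)\<close>, and in both cases
  \<open>binom(\<bar>d\<bar>, 2) + max i j = binom(i + 1, 2) + binom(j + 1, 2) - i j\<close>. The absolute value and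
  the maximum are gone, and the only coupling between \<open>i\<close> and \<open>j\<close> left in each exponent is
  \<open>- i j\<close>, which the factor \<open>q^((a - i) (b - j))\<close> cancels (\<open>summand_weight\<close>).

  Writing \<open>P\<^sub>n(x) = (1 - x) (1 - q x) \<dots> (1 - q^(n-1) x)\<close>, the sum therefore equals \<open>q^(a b)\<close> times
  \<open>P\<^sub>a(q^(-b)) P\<^sub>b(q^(1-a)) + P\<^sub>a(q^(1-b)) P\<^sub>b(q^(-a)) - P\<^sub>a(q^(1-b)) P\<^sub>b(q^(1-a))\<close>.
  If \<open>a, b \<ge> 1\<close>, each of the three products contains a zero factor, because \<open>P\<^sub>n\<close> vanishes at
  \<open>1, q^(-1), \<dots>, q^(1-n)\<close>. If \<open>a = 0\<close>, two products cancel and \<open>P\<^sub>b(1)\<close> remains, which is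
  \<open>1\<close> for \<open>b = 0\<close> and \<open>0\<close> otherwise; \<open>b = 0\<close> is symmetric.
\<close>

section \<open>The q-binomial theorem\<close>

lemma qnum_add: "qnum q (m + n) = qnum q m + real q ^ m * qnum q n"
proof (induction n)
  case 0
  then show ?case by (simp add: qnum_def)
next
  case (Suc n)
  then show ?case by (simp add: qnum_def power_add algebra_simps)
qed

lemma qfact_Suc: "qfact q (Suc n) = qfact q n * qnum q (Suc n)"
  by (simp add: qfact_def)

lemma qbinom_eq_0: "n < k \<Longrightarrow> qbinom q n k = 0"
  by (simp add: qbinom_def)

text \<open>
  The \<open>q\<close>-Pascal rule is the splitting
  \<open>[n + 1] = [n - k] + q^(n - k) [k + 1]\<close> of \<open>q\<close>-numbers over a common denominator.
\<close>

lemma qbinom_Suc_Suc: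
  assumes "q > 0" "k \<le> n"
  shows "qbinom q (Suc n) (Suc k) = qbinom q n (Suc k) + real q ^ (n - k) * qbinom q n k"
proof (cases "k = n")
  case True
  then show ?thesis using assms by (simp add: qbinom_self qbinom_eq_0)
next
  case False
  then obtain m where n: "n = k + Suc m"
    using assms(2) less_imp_Suc_add by (metis add_Suc_right le_neq_implies_less)
  have pos: "qfact q r > 0" "qnum q (Suc r) > 0" for r
    using assms(1) by (auto intro: qfact_pos qnum_pos)
  have split: "qnum q (Suc n) = qnum q (Suc m) + real q ^ Suc m * qnum q (Suc k)"
    using qnum_add[of q "Suc m" "Suc k"] by (simp add: n add.commute)
  have "qbinom q (Suc n) (Suc k)
      = qfact q n * qnum q (Suc n) / (qfact q k * qnum q (Suc k) * (qfact q m * qnum q (Suc m)))"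
    by (simp add: qbinom_def n qfact_Suc)
  also have "\<dots> = qfact q n / (qfact q k * qnum q (Suc k) * qfact q m)
      + real q ^ Suc m * (qfact q n / (qfact q k * (qfact q m * qnum q (Suc m))))"
    using pos(1)[of k] pos(1)[of m] pos(2)[of k] pos(2)[of m]
    unfolding split by (simp add: field_simps)
  also have "qfact q n / (qfact q k * qnum q (Suc k) * qfact q m) = qbinom q n (Suc k)"
    by (simp add: qbinom_def n qfact_Suc)
  also have "qfact q n / (qfact q k * (qfact q m * qnum q (Suc m))) = qbinom q n k"
    by (simp add: qbinom_def n qfact_Suc)
  finally show ?thesis by (simp add: n)
qed

definition qpochhammer :: "nat \<Rightarrow> nat \<Rightarrow> real \<Rightarrow> real" where
  "qpochhammer q n x = (\<Prod>k<n. 1 - real q ^ k * x)"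

lemma qpochhammer_0 [simp]: "qpochhammer q 0 x = 1"
  by (simp add: qpochhammer_def)

text \<open>
  Multiplying by the new factor \<open>1 - q^n x\<close> combines neighbouring coefficients exactly as in the
  \<open>q\<close>-Pascal rule, since \<open>binom(i + 1, 2) = binom(i, 2) + i\<close>.
\<close>

theorem qbinomial_theorem:
  assumes "q > 0"
  shows "(\<Sum>i\<le>n. (-1) ^ i * qbinom q n i * real q ^ (i choose 2) * x ^ i) = qpochhammer q n x"
proof (induction n)
  case 0
  then show ?case using assms by (simp add: qbinom_0 binomial_eq_0)
next
  case (Suc n)
  define t where "t m i = (-1) ^ i * qbinom q m i * real q ^ (i choose 2) * x ^ i" for m i
  have t_Suc: "t (Suc n) (Suc i) = t n (Suc i) - real q ^ n * x * t n i" if "i \<le> n" for i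
  proof -
    have choose: "Suc i choose 2 = (i choose 2) + i"
      by (simp add: numeral_2_eq_2)
    have "real q ^ n = real q ^ (n - i) * real q ^ i"
      using that by (simp flip: power_add)
    then show ?thesis
      unfolding t_def qbinom_Suc_Suc[OF assms that] choose
      by (simp add: power_add algebra_simps)
  qed
  have t_0: "t (Suc n) 0 = t n 0"
    using assms by (simp add: t_def qbinom_0)
  have "(\<Sum>i\<le>Suc n. t (Suc n) i) = t (Suc n) 0 + (\<Sum>i\<le>n. t (Suc n) (Suc i))"
    by (rule sum.atMost_Suc_shift)
  also have "\<dots> = (t n 0 + (\<Sum>i\<le>n. t n (Suc i))) - real q ^ n * x * (\<Sum>i\<le>n. t n i)"
    by (simp add: t_0 t_Suc sum_subtractf sum_distrib_left)
  also have "t n 0 + (\<Sum>i\<le>n. t n (Suc i)) = (\<Sum>i\<le>Suc n. t n i)"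
    by (rule sum.atMost_Suc_shift[symmetric])
  also have "\<dots> = (\<Sum>i\<le>n. t n i)"
    by (simp add: t_def qbinom_eq_0)
  finally show ?case
    using Suc.IH by (simp add: t_def qpochhammer_def algebra_simps)
qed

lemma qpochhammer_eq_0:
  assumes "q > 0" "m < n"
  shows "qpochhammer q n (1 / real q ^ m) = 0"
  using assms by (auto simp: qpochhammer_def intro!: bexI[of _ m])

lemma qpochhammer_shift_eq_0:
  assumes "q > 0" "0 < m" "m \<le> n"
  shows "qpochhammer q n (real q / real q ^ m) = 0"
proof -
  have "real q / real q ^ m = 1 / real q ^ (m - 1)"
    using assms by (cases m) auto
  then show ?thesis using assms qpochhammer_eq_0[of q "m - 1" n] by simp
qed

section \<open>Decoupling the two indices\<close>

lemma choose_two_add: "(m + n) choose 2 = (m choose 2) + (n choose 2) + m * n"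
  by (induction n) (simp_all add: numeral_2_eq_2)

text \<open>
  Substituting \<open>i = j + d\<close> turns the three exponents into polynomials in natural numbers, and
  each claimed monomial identity becomes an identity between exponents once the negative powers
  are cleared; all three rest on \<open>2 binom(j, 2) + j = j\<^sup>2\<close>.
\<close>

lemma summand_weight_ordered:
  assumes "q > 0" "i \<le> a" "j \<le> b" "j \<le> i"
  shows "real q ^ ((a - i) * (b - j)) * real q ^ ((i - j) choose 2)
      * (1 + real q ^ (i - j) - real q ^ i)
    = real q ^ (a * b) * real q ^ (i choose 2) * real q ^ (j choose 2)
      * ((1 / real q ^ b) ^ i * (real q / real q ^ a) ^ j
        + (real q / real q ^ b) ^ i * (1 / real q ^ a) ^ j
        - (real q / real q ^ b) ^ i * (real q / real q ^ a) ^ j)"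
proof -
  obtain m n d where a: "a = i + m" and b: "b = j + n" and i: "i = j + d"
    using assms(2-4) le_Suc_ex by metis
  have sq: "2 * (j choose 2) + j = j * j"
    by (induction j) (simp_all add: numeral_2_eq_2)
  let ?E = "m * n + (d choose 2) + (b * i + a * j)"
  let ?F = "a * b + (i choose 2) + (j choose 2)"
  have e1: "?E = ?F + j"
    using sq unfolding a b i choose_two_add by (simp add: algebra_simps)
  have exponents: "?E = ?F + j" "?E + d = ?F + i" "?E + i = ?F + (i + j)"
    using e1 i by simp_all
  let ?D = "real q ^ (b * i + a * j)"
  have D: "?D \<noteq> 0" using assms(1) by simp
  have "real q ^ (m * n) * real q ^ (d choose 2) * (1 + real q ^ d - real q ^ i) * ?D
      = real q ^ ?E + real q ^ (?E + d) - real q ^ (?E + i)"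
    by (simp add: power_add algebra_simps)
  also have "\<dots> = real q ^ (?F + j) + real q ^ (?F + i) - real q ^ (?F + (i + j))"
    unfolding exponents(2,3) unfolding exponents(1) ..
  also have "\<dots> = real q ^ (a * b) * real q ^ (i choose 2) * real q ^ (j choose 2)
      * (real q ^ j + real q ^ i - real q ^ i * real q ^ j)"
    by (simp add: power_add algebra_simps)
  also have "\<dots> = real q ^ (a * b) * real q ^ (i choose 2) * real q ^ (j choose 2)
      * ((1 / real q ^ b) ^ i * (real q / real q ^ a) ^ j
        + (real q / real q ^ b) ^ i * (1 / real q ^ a) ^ j
        - (real q / real q ^ b) ^ i * (real q / real q ^ a) ^ j) * ?D"
  proof -
    have "real q ^ j + real q ^ i - real q ^ i * real q ^ j
      = ((1 / real q ^ b) ^ i * (real q / real q ^ a) ^ j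
        + (real q / real q ^ b) ^ i * (1 / real q ^ a) ^ j
        - (real q / real q ^ b) ^ i * (real q / real q ^ a) ^ j) * ?D"
      using assms(1) by (simp add: power_divide power_mult power_add field_simps)
    then show ?thesis by (simp only: mult.assoc)
  qed
  finally have cleared: "real q ^ (m * n) * real q ^ (d choose 2) * (1 + real q ^ d - real q ^ i)
    = real q ^ (a * b) * real q ^ (i choose 2) * real q ^ (j choose 2)
      * ((1 / real q ^ b) ^ i * (real q / real q ^ a) ^ j
        + (real q / real q ^ b) ^ i * (1 / real q ^ a) ^ j
        - (real q / real q ^ b) ^ i * (real q / real q ^ a) ^ j)"
    unfolding mult_right_cancel[OF D] .
  have "a - i = m" "b - j = n" "i - j = d"
    by (simp_all add: a b i)
  then show ?thesis
    using cleared by (simp only:)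
qed

text \<open>Both sides are invariant under exchanging \<open>(i, a)\<close> with \<open>(j, b)\<close>, so the order of \<open>i\<close> and \<open>j\<close>
  does not matter.\<close>

lemma summand_weight:
  assumes "q > 0" "i \<le> a" "j \<le> b"
  shows "real q ^ ((a - i) * (b - j)) * real q ^ (nat \<bar>int i - int j\<bar> choose 2)
      * (1 + real q ^ nat \<bar>int i - int j\<bar> - real q ^ max i j)
    = real q ^ (a * b) * real q ^ (i choose 2) * real q ^ (j choose 2)
      * ((1 / real q ^ b) ^ i * (real q / real q ^ a) ^ j
        + (real q / real q ^ b) ^ i * (1 / real q ^ a) ^ j
        - (real q / real q ^ b) ^ i * (real q / real q ^ a) ^ j)"
proof (cases "j \<le> i")
  case True
  then have "nat \<bar>int i - int j\<bar> = i - j" "max i j = i" by auto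
  then show ?thesis using summand_weight_ordered[OF assms True] by simp
next
  case False
  then have "nat \<bar>int i - int j\<bar> = j - i" "max i j = j" "i \<le> j" by auto
  then show ?thesis
    using summand_weight_ordered[OF assms(1,3,2) \<open>i \<le> j\<close>] by (simp add: algebra_simps)
qed

lemma sum_N_eq_qpochhammer:
  assumes "q > 0"
  shows "(\<Sum>i\<le>a. \<Sum>j\<le>b. N q i j a b) = real q ^ (a * b) *
    (qpochhammer q a (1 / real q ^ b) * qpochhammer q b (real q / real q ^ a)
      + qpochhammer q a (real q / real q ^ b) * qpochhammer q b (1 / real q ^ a)
      - qpochhammer q a (real q / real q ^ b) * qpochhammer q b (real q / real q ^ a))"
proof -
  define t where "t n x i = (-1) ^ i * qbinom q n i * real q ^ (i choose 2) * x ^ i"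
    for n i and x :: real
  have sum_t: "(\<Sum>i\<le>n. t n x i) = qpochhammer q n x" for n x
    unfolding t_def by (rule qbinomial_theorem[OF assms])
  have N: "N q i j a b = real q ^ (a * b) *
      (t a (1 / real q ^ b) i * t b (real q / real q ^ a) j
        + t a (real q / real q ^ b) i * t b (1 / real q ^ a) j
        - t a (real q / real q ^ b) i * t b (real q / real q ^ a) j)"
    if "i \<le> a" "j \<le> b" for i j
  proof -
    have "N q i j a b = (-1) ^ (i + j) * qbinom q a i * qbinom q b j
      * (real q ^ ((a - i) * (b - j)) * real q ^ (nat \<bar>int i - int j\<bar> choose 2)
      * (1 + real q ^ nat \<bar>int i - int j\<bar> - real q ^ max i j))"
      by (simp only: N_explicit[OF assms] mult.assoc)
    also have "\<dots> = real q ^ (a * b) *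
      (t a (1 / real q ^ b) i * t b (real q / real q ^ a) j
        + t a (real q / real q ^ b) i * t b (1 / real q ^ a) j
        - t a (real q / real q ^ b) i * t b (real q / real q ^ a) j)"
      unfolding summand_weight[OF assms that] t_def power_add by algebra
    finally show ?thesis .
  qed
  have "(\<Sum>i\<le>a. \<Sum>j\<le>b. N q i j a b) = (\<Sum>i\<le>a. \<Sum>j\<le>b. real q ^ (a * b) *
      (t a (1 / real q ^ b) i * t b (real q / real q ^ a) j
        + t a (real q / real q ^ b) i * t b (1 / real q ^ a) j
        - t a (real q / real q ^ b) i * t b (real q / real q ^ a) j))"
    by (intro sum.cong refl N) auto
  then show ?thesis
    by (simp only: sum_t[symmetric] sum_product sum.distrib sum_subtractf
        sum_distrib_left[symmetric])
qed

section \<open>Evaluating the sum\<close>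

theorem theorem61:
  fixes q a b :: nat
  assumes "primepow q \<or> q = 1"
  shows "(\<Sum>i=0..a. \<Sum>j=0..b. N q i j a b) =
    (if a = 0 then 1 else 0) * (if b = 0 then 1 else 0)"
proof -
  have q: "q > 0" using assms by (auto intro: primepow_gt_0_nat)
  have at_1: "qpochhammer q n 1 = (if n = 0 then 1 else 0)" for n
    using qpochhammer_eq_0[OF q, of 0 n] by simp
  have "real q ^ (a * b) *
    (qpochhammer q a (1 / real q ^ b) * qpochhammer q b (real q / real q ^ a)
      + qpochhammer q a (real q / real q ^ b) * qpochhammer q b (1 / real q ^ a)
      - qpochhammer q a (real q / real q ^ b) * qpochhammer q b (real q / real q ^ a))
    = (if a = 0 then 1 else 0) * (if b = 0 then 1 else 0)"
  proof (cases "a = 0 \<or> b = 0")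
    case True
    then show ?thesis by (auto simp: at_1)
  next
    case False
    \<comment> \<open>Which factor vanishes depends on the order of \<open>a\<close> and \<open>b\<close>. In the first two products
      the tie \<open>a = b\<close> goes to the factor whose argument carries the extra \<open>q\<close>.\<close>
    have "qpochhammer q a (1 / real q ^ b) * qpochhammer q b (real q / real q ^ a) = 0"
      using False qpochhammer_eq_0[OF q, of b a] qpochhammer_shift_eq_0[OF q, of a b]
      by (cases "a \<le> b") auto
    moreover have "qpochhammer q a (real q / real q ^ b) * qpochhammer q b (1 / real q ^ a) = 0"
      using False qpochhammer_eq_0[OF q, of a b] qpochhammer_shift_eq_0[OF q, of b a]
      by (cases "b \<le> a") auto
    moreover have
      "qpochhammer q a (real q / real q ^ b) * qpochhammer q b (real q / real q ^ a) = 0"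
      using False qpochhammer_shift_eq_0[OF q, of a b] qpochhammer_shift_eq_0[OF q, of b a]
      by (cases "b \<le> a") auto
    ultimately show ?thesis using False by (simp del: mult_eq_0_iff)
  qed
  then show ?thesis
    using sum_N_eq_qpochhammer[OF q, of a b] by (simp only: atMost_atLeast0)
qed

end
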